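(* Let $(G=(V,E),d,K,V_0,\bar{x},<)$ be a GDMDGP instance (defined in the context) and let $X$ be the set of embeddings $x:V\to\mathbb{R}^K$ extending $\bar{x}$ that are valid for $G$. Let $y\in X$ and $v\in V\setminus V_0$, and suppose there exists $y'\in X$ with $y'_w=y_w$ for all $w<v$ and $y'_v\neq y_v$. Let $R^v:\mathbb{R}^K\to\mathbb{R}^K$ be the Euclidean reflection with respect to the affine hyperplane through the $K$ points $\{y_u: u\in U_v\}$, and define $\tilde{R}^v y:V\to\mathbb{R}^K$ by $(\tilde{R}^v y)_w=y_w$ for $w<v$ and $(\tilde{R}^v y)_w=R^v y_w$ for $w\ge v$. Then, with probability $1$, $\tilde{R}^v y\in X$.
   Context: An instance of the GDMDGP consists of a simple undirected graph $G=(V,E)$ with $n=|V|$, an edge weight function $d:E\to\mathbb{R}_+$ (write $d_{uv}$), an integer $K>0$, a total order $<$ on $V$, a subset $V_0\subseteq V$ with $|V_0|=K$, and a map $\bar{x}:V_0\to\mathbb{R}^K$ valid for $G[V_0]$. For $v\in V$ let $N(v)$ be its set of neighbours, $\gamma(v)=\{u: u<v\}$ and $\rho(v)=|\gamma(v)|+1$. A map $x:V'\to\mathbb{R}^K$ is valid for $G[V']$ if $\|x_u-x_v\|=d_{uv}$ for all edges $\{u,v\}$ with $u,v\in V'$. Requirements: $V_0=\{v:\rho(v)\le K\}$; every $v$ with $\rho(v)>K$ has $|N(v)\cap\gamma(v)|\ge K$; for every $v\in V\setminus V_0$ a set $U_v\subseteq N(v)\cap\gamma(v)$ with $|U_v|=K$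 is fixed, all of whose elements $u$ satisfy $\rho(v)-K\le\rho(u)\le\rho(v)-1$, with $G[U_v]$ complete and the strict simplex inequality $\Delta_{K-1}(U_v)>0$ (the Cayley–Menger volume of the $(K-1)$-simplex with edge lengths $d$ on $U_v$ is positive; equivalently the points of $U_v$ are affinely independent in any valid embedding). "With probability 1" refers to the paper's standing assumption that any point of $\mathbb{R}^K$ lies in any given Lebesgue-null subset of $\mathbb{R}^K$ with probability zero (generic data). *)

theory Defs
  imports "HOL-Probability.Probability"
begin

definition nbrs :: "'v set set \<Rightarrow> 'v \<Rightarrow> 'v set" where
  "nbrs E v = {u. {u, v} \<in> E}"

definition preds :: "'v::linorder set \<Rightarrow> 'v \<Rightarrow> 'v set" where
  "preds V v = {u \<in> V. u < v}"

definition rank_of :: "'v::linorder set \<Rightarrow> 'v \<Rightarrow> nat" where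
  "rank_of V v = card (preds V v) + 1"

text \<open>\<open>x\<close> is valid for the subgraph of \<open>(V, E)\<close> induced by \<open>W\<close>.\<close>
definition valid_on :: "'v set set \<Rightarrow> ('v set \<Rightarrow> real) \<Rightarrow> 'v set \<Rightarrow> ('v \<Rightarrow> 'a::real_normed_vector) \<Rightarrow> bool" where
  "valid_on E d W x \<longleftrightarrow> (\<forall>u\<in>W. \<forall>v\<in>W. {u, v} \<in> E \<longrightarrow> norm (x u - x v) = d {u, v})"

text \<open>The vertices \<open>p i\<close> of the simplex are indexed by \<open>'k\<close>; the index \<open>None\<close> is the
  bordering row and column of ones.\<close>
definition cayley_menger :: "('v set \<Rightarrow> real) \<Rightarrow> ('k::finite \<Rightarrow> 'v) \<Rightarrow> real" where
  "cayley_menger d p = det ((\<chi> i j. case i of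
       None \<Rightarrow> (case j of None \<Rightarrow> 0 | Some b \<Rightarrow> 1)
     | Some a \<Rightarrow> (case j of None \<Rightarrow> 1
                        | Some b \<Rightarrow> if a = b then 0 else (d {p a, p b})\<^sup>2)) :: real ^ 'k option ^ 'k option)"

text \<open>The volume of the simplex with the \<open>K = CARD('k)\<close> vertices \<open>p i\<close>, i.e. of dimension
  \<open>K - 1\<close>. Since \<open>sqrt\<close> is an odd function on all reals, the volume is positive iff the radicand is.\<close>
definition simplex_volume :: "('v set \<Rightarrow> real) \<Rightarrow> ('k::finite \<Rightarrow> 'v) \<Rightarrow> real" where
  "simplex_volume d p =
     sqrt ((- 1) ^ CARD('k) / (2 ^ (CARD('k) - 1) * (fact (CARD('k) - 1))\<^sup>2) * cayley_menger d p)"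

text \<open>The dimension \<open>K\<close> is \<open>CARD('k)\<close>. In \<open>simplex_pos\<close>, the volume does not depend on the
  enumeration \<open>p\<close> of \<open>U v\<close>, and there is one because \<open>card (U v) = CARD('k)\<close>.\<close>
locale gdmdgp =
  fixes V :: "'v::linorder set"
    and E :: "'v set set"
    and d :: "'v set \<Rightarrow> real"
    and V0 :: "'v set"
    and xbar :: "'v \<Rightarrow> real ^ 'k"
    and U :: "'v \<Rightarrow> 'v set"
  assumes finite_V: "finite V"
    and simple_graph: "E \<subseteq> {{u, v} | u v. u \<in> V \<and> v \<in> V \<and> u \<noteq> v}"
    and weight_nonneg: "\<And>e. e \<in> E \<Longrightarrow> 0 \<le> d e"
    and V0_subset: "V0 \<subseteq> V"
    and card_V0: "card V0 = CARD('k)"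
    and xbar_valid: "valid_on E d V0 xbar"
    and V0_initial: "V0 = {v \<in> V. rank_of V v \<le> CARD('k)}"
    and enough_preds: "\<And>v. \<lbrakk>v \<in> V; CARD('k) < rank_of V v\<rbrakk> \<Longrightarrow> CARD('k) \<le> card (nbrs E v \<inter> preds V v)"
    and U_subset: "\<And>v. v \<in> V - V0 \<Longrightarrow> U v \<subseteq> nbrs E v \<inter> preds V v"
    and card_U: "\<And>v. v \<in> V - V0 \<Longrightarrow> card (U v) = CARD('k)"
    and U_rank: "\<And>v u. \<lbrakk>v \<in> V - V0; u \<in> U v\<rbrakk> \<Longrightarrow>
          rank_of V v - CARD('k) \<le> rank_of V u \<and> rank_of V u \<le> rank_of V v - 1"
    and U_complete: "\<And>v a b. \<lbrakk>v \<in> V - V0; a \<in> U v; b \<in> U v; a \<noteq> b\<rbrakk> \<Longrightarrow> {a, b} \<in> E"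
    and simplex_pos: "\<And>v (p :: 'k \<Rightarrow> 'v). \<lbrakk>v \<in> V - V0; bij_betw p UNIV (U v)\<rbrakk> \<Longrightarrow> simplex_volume d p > 0"

text \<open>The set \<open>X\<close>. Maps on \<open>V\<close> are functions that are \<open>undefined\<close> outside \<open>V\<close>.\<close>
definition embeddings ::
    "'v set \<Rightarrow> 'v set set \<Rightarrow> ('v set \<Rightarrow> real) \<Rightarrow> 'v set \<Rightarrow> ('v \<Rightarrow> 'a::real_normed_vector) \<Rightarrow> ('v \<Rightarrow> 'a) set" where
  "embeddings V E d V0 xbar = {x \<in> V \<rightarrow>\<^sub>E UNIV. (\<forall>v\<in>V0. x v = xbar v) \<and> valid_on E d V x}"

text \<open>Euclidean reflection with respect to an affine subspace \<open>H\<close>; \<open>closest_point H\<close> is the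
  orthogonal projection onto \<open>H\<close>.\<close>
definition reflect_in :: "'a::euclidean_space set \<Rightarrow> 'a \<Rightarrow> 'a" where
  "reflect_in H x = 2 *\<^sub>R closest_point H x - x"

text \<open>For affinely independent \<open>y u\<close>, \<open>u \<in> U v\<close>, the affine hull is the hyperplane through these points.\<close>
definition partial_reflection ::
    "'v::linorder set \<Rightarrow> ('v \<Rightarrow> 'v set) \<Rightarrow> 'v \<Rightarrow> ('v \<Rightarrow> 'a::euclidean_space) \<Rightarrow> 'v \<Rightarrow> 'a" where
  "partial_reflection V U v y =
     (\<lambda>w\<in>V. if w < v then y w else reflect_in (affine hull (y ` U v)) (y w))"

text \<open>The random points \<open>Z \<omega> i\<close>, \<open>i \<in> I\<close>, avoid every given Lebesgue-null set almost surely.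
  The null sets are those of the joint configuration space, so a null set for one point may depend
  on the positions of the other points.\<close>
definition generic_points :: "'w measure \<Rightarrow> 'i set \<Rightarrow> ('w \<Rightarrow> 'i \<Rightarrow> 'a::euclidean_space) \<Rightarrow> bool" where
  "generic_points M I Z \<longleftrightarrow>
     (\<lambda>\<omega>. restrict (Z \<omega>) I) \<in> M \<rightarrow>\<^sub>M (\<Pi>\<^sub>M i\<in>I. lborel) \<and>
     absolutely_continuous (\<Pi>\<^sub>M i\<in>I. lborel) (distr M (\<Pi>\<^sub>M i\<in>I. lborel) (\<lambda>\<omega>. restrict (Z \<omega>) I))"

end

theory Submission
  imports Defs
begin

text \<open>
  The rank condition forces \<open>U v\<close> to consist of the \<open>K\<close> immediate predecessors of \<open>v\<close>. So, numbering the
  vertices, every embedding \<open>y\<close> arises from the generic one \<open>z\<close> by a set \<open>S\<close> of partial reflections: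
  \<open>y w = R v1 (R v2 (\<dots> (z w)))\<close>, where \<open>v1 < v2 < \<dots>\<close> are the elements of \<open>S\<close> up to \<open>w\<close> and \<open>R v\<close> reflects
  in the hyperplane through the \<open>K\<close> points of \<open>z\<close> preceding \<open>v\<close>.

  Suppose an edge \<open>{u, w}\<close> with \<open>u + K < w\<close> keeps its length although \<open>S\<close> meets \<open>{u + K<..w}\<close>, say in
  \<open>v1 < \<dots> < vm\<close>. Then \<open>z w\<close> is equidistant from \<open>z u\<close> and \<open>q = R vm (\<dots> (R v1 (z u)))\<close>, points that depend
  only on the positions before \<open>w\<close>; generically this forces \<open>q = z u\<close>. For \<open>m = 1\<close> that puts \<open>z u\<close> on the
  mirror of \<open>v1\<close>; for \<open>m > 1\<close> it makes \<open>z (vm - 1)\<close>, which lies on the mirror of \<open>vm\<close>, equidistant from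
  \<open>z u\<close> and \<open>R v(m-1) (\<dots> (R v1 (z u)))\<close>. Both are excluded generically. So an edge across \<open>v\<close> that
  does not start in \<open>U v\<close> leaves no choice at \<open>v\<close>, contrary to the existence of \<open>y'\<close>; without such edges
  the partial reflection preserves all edge lengths.
\<close>

section \<open>Simplices and reflections in hyperplanes\<close>

text \<open>Here \<open>undefined\<close> is merely some fixed index: the simplex vertex from which edges are drawn.\<close>
definition edge_matrix :: "('k::finite \<Rightarrow> real ^ 'k) \<Rightarrow> real ^ 'k \<Rightarrow> real ^ 'k ^ 'k" where
  "edge_matrix p x = (\<chi> r. if r = undefined then x else p r - p undefined)"

text \<open>The generalised cross product of the edges. It makes the reflection below a measurable function of
  the vertices, also in the degenerate case, where the normal is \<open>0\<close> and the reflection is the identity.\<close>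
definition normal :: "('k::finite \<Rightarrow> real ^ 'k) \<Rightarrow> real ^ 'k" where
  "normal p = (\<chi> i. det (edge_matrix p (axis i 1)))"

definition mirror :: "('k::finite \<Rightarrow> real ^ 'k) \<Rightarrow> real ^ 'k \<Rightarrow> real ^ 'k" where
  "mirror p x = x - (2 * (normal p \<bullet> (x - p undefined)) / (normal p \<bullet> normal p)) *\<^sub>R normal p"

lemma linear_det_edge_matrix:
  fixes p :: "'k::finite \<Rightarrow> real ^ 'k"
  shows "linear (\<lambda>x. det (edge_matrix p x))"
proof (rule linearI)
  fix x y :: "real ^ 'k" and c :: real
  show "det (edge_matrix p (x + y)) = det (edge_matrix p x) + det (edge_matrix p y)"
    unfolding edge_matrix_def by (rule det_row_add)
  show "det (edge_matrix p (c *\<^sub>R x)) = c *\<^sub>R det (edge_matrix p x)"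
    unfolding edge_matrix_def scalar_mult_eq_scaleR[symmetric] real_scaleR_def by (rule det_row_mul)
qed

lemma normal_inner: "normal p \<bullet> x = det (edge_matrix p x)"
proof -
  have "det (edge_matrix p x) = det (edge_matrix p (\<Sum>i\<in>UNIV. (x $ i) *\<^sub>R axis i 1))"
    by (simp add: basis_expansion[of x, unfolded scalar_mult_eq_scaleR])
  also have "\<dots> = (\<Sum>i\<in>UNIV. x $ i * det (edge_matrix p (axis i 1)))"
    by (simp add: linear_sum[OF linear_det_edge_matrix] linear_cmul[OF linear_det_edge_matrix])
  also have "\<dots> = normal p \<bullet> x"
    by (simp add: inner_vec_def normal_def mult.commute)
  finally show ?thesis ..
qed

lemma normal_orthogonal: "normal p \<bullet> (p r - p s) = 0"
proof -
  have *: "normal p \<bullet> (p r - p undefined) = 0" for r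
  proof (cases "r = undefined")
    case False
    then show ?thesis unfolding normal_inner
      by (intro det_identical_rows[of undefined r]) (auto simp: edge_matrix_def row_def vec_eq_iff)
  qed simp
  have "p r - p s = (p r - p undefined) - (p s - p undefined)" by simp
  then show ?thesis using *[of r] *[of s] by (simp only: inner_diff_right)
qed

lemma mirror_fixes: "mirror p (p r) = p r"
  by (simp add: mirror_def normal_orthogonal)

lemma mirror_mirror: "mirror p (mirror p x) = x"
proof (cases "normal p = 0")
  case False
  then have "normal p \<bullet> (mirror p x - p undefined) = - (normal p \<bullet> (x - p undefined))"
    by (simp add: mirror_def inner_diff_right)
  then show ?thesis
    by (subst mirror_def) (simp add: mirror_def)
qed (simp add: mirror_def)

lemma dist_mirror: "dist (mirror p x) (mirror p y) = dist x y"
proof (cases "normal p = 0")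
  case False
  define n where "n = normal p"
  define t where "t = 2 * (n \<bullet> (x - y)) / (n \<bullet> n)"
  have "mirror p x - mirror p y = (x - y) - t *\<^sub>R n"
    by (simp add: mirror_def n_def t_def algebra_simps inner_diff_right diff_divide_distrib)
  moreover have "((x - y) - t *\<^sub>R n) \<bullet> ((x - y) - t *\<^sub>R n) = (x - y) \<bullet> (x - y)"
  proof -
    have "t * (n \<bullet> n) = 2 * (n \<bullet> (x - y))" using False by (simp add: t_def n_def)
    then have "t * (t * (n \<bullet> n)) = t * (2 * (n \<bullet> (x - y)))" by simp
    then show ?thesis
      by (simp add: inner_diff_left inner_diff_right inner_commute algebra_simps)
  qed
  ultimately show ?thesis by (simp add: dist_norm norm_eq_sqrt_inner)
qed (simp add: mirror_def)

lemma mirror_eq_iff: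
  assumes "normal p \<noteq> 0"
  shows "mirror p x = x \<longleftrightarrow> normal p \<bullet> (x - p undefined) = 0"
  using assms by (simp add: mirror_def)

lemma equidistant_imp_mirror:
  assumes n: "normal p \<noteq> 0" and d: "\<And>r. dist a (p r) = dist b (p r)"
  shows "a = b \<or> a = mirror p b"
proof -
  define n where "n = normal p"
  define p0 where "p0 = p undefined"
  have nn: "n \<bullet> n \<noteq> 0" using assms by (simp add: n_def)
  have dd: "(a - p r) \<bullet> (a - p r) = (b - p r) \<bullet> (b - p r)" for r
    using d[of r] by (simp add: dist_norm norm_eq_sqrt_inner)
  have orth: "(a - b) \<bullet> (p r - p0) = 0" for r
    using dd[of r] dd[of undefined]
    by (simp add: inner_diff_left inner_diff_right inner_commute algebra_simps p0_def)
  define s where "s = ((a - b) \<bullet> n) / (n \<bullet> n)"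
  define x where "x = (a - b) - s *\<^sub>R n"
  have "edge_matrix p n *v x = 0"
  proof -
    have "row r (edge_matrix p n) \<bullet> x = 0" for r
    proof (cases "r = undefined")
      case True
      then have "row r (edge_matrix p n) = n" by (simp add: edge_matrix_def row_def vec_eq_iff)
      then show ?thesis using nn by (simp add: x_def s_def inner_diff_right inner_commute)
    next
      case False
      then have "row r (edge_matrix p n) = p r - p0" by (simp add: edge_matrix_def row_def vec_eq_iff p0_def)
      moreover have "(p r - p0) \<bullet> n = 0" using normal_orthogonal[of p r undefined] by (simp add: n_def p0_def inner_commute)
      ultimately show ?thesis using orth[of r] by (simp add: x_def inner_diff_right inner_commute)
    qed
    then show ?thesis
      by (simp add: vec_eq_iff matrix_vector_mult_def inner_vec_def row_def)
  qed
  moreover have "invertible (edge_matrix p n)"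
    using nn by (simp add: invertible_det_nz normal_inner[symmetric] n_def)
  ultimately have "x = 0"
    using invertible_eq_bij inj_matrix_vector_mult
    by (metis injD matrix_vector_mult_0_right)
  then have a: "a = b + s *\<^sub>R n" by (simp add: x_def algebra_simps)
  have "s * (2 * (n \<bullet> (b - p0)) + s * (n \<bullet> n)) = 0"
    using dd[of undefined] unfolding a p0_def[symmetric]
    by (simp add: inner_diff_left inner_diff_right inner_add_left inner_add_right inner_commute algebra_simps)
  then have "s = 0 \<or> 2 * (n \<bullet> (b - p0)) + s * (n \<bullet> n) = 0"
    by (simp only: mult_eq_0_iff)
  then have "s = 0 \<or> s = - (2 * (n \<bullet> (b - p0)) / (n \<bullet> n))"
    using nn by (auto simp: field_simps add_eq_0_iff)
  then show ?thesis
    by (auto simp: a mirror_def n_def p0_def)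
qed

text \<open>Affine independence of a family, so that coinciding points count as dependent.\<close>
definition aff_indep :: "('i \<Rightarrow> 'a::real_vector) \<Rightarrow> 'i set \<Rightarrow> bool" where
  "aff_indep z A \<longleftrightarrow>
     (\<forall>c. (\<Sum>i\<in>A. c i) = 0 \<longrightarrow> (\<Sum>i\<in>A. c i *\<^sub>R z i) = 0 \<longrightarrow> (\<forall>i\<in>A. c i = 0))"

lemma aff_indep_cong:
  assumes "\<And>i. i \<in> A \<Longrightarrow> z i = z' i"
  shows "aff_indep z A \<longleftrightarrow> aff_indep z' A"
proof -
  have "(\<Sum>i\<in>A. c i *\<^sub>R z i) = (\<Sum>i\<in>A. c i *\<^sub>R z' i)" for c :: "'a \<Rightarrow> real"
    using assms by (intro sum.cong) auto
  then show ?thesis by (simp add: aff_indep_def)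
qed

lemma aff_indep_subset:
  assumes "aff_indep z A" "B \<subseteq> A" "finite A"
  shows "aff_indep z B"
  unfolding aff_indep_def
proof (intro allI impI)
  fix c :: "'a \<Rightarrow> real"
  assume c: "(\<Sum>i\<in>B. c i) = 0" "(\<Sum>i\<in>B. c i *\<^sub>R z i) = 0"
  let ?c = "\<lambda>i. if i \<in> B then c i else 0"
  have "(\<Sum>i\<in>A. ?c i) = (\<Sum>i\<in>B. ?c i)"
    by (rule sum.mono_neutral_right) (use assms in auto)
  moreover have "(\<Sum>i\<in>A. ?c i *\<^sub>R z i) = (\<Sum>i\<in>B. ?c i *\<^sub>R z i)"
    by (rule sum.mono_neutral_right) (use assms in auto)
  ultimately have "\<forall>i\<in>A. ?c i = 0"
    using c by (intro assms(1)[unfolded aff_indep_def, rule_format, THEN ballI]) simp_all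
  then show "\<forall>i\<in>B. c i = 0" using assms(2) by (metis subsetD)
qed

lemma aff_indep_reindex:
  assumes "bij_betw p B A"
  shows "aff_indep z A \<longleftrightarrow> aff_indep (z \<circ> p) B"
proof
  have inj: "inj_on p B" and A: "A = p ` B" using assms by (auto simp: bij_betw_def)
  show "aff_indep z A" if h: "aff_indep (z \<circ> p) B"
    unfolding aff_indep_def
  proof (intro allI impI)
    fix c :: "'b \<Rightarrow> real"
    assume "(\<Sum>i\<in>A. c i) = 0" "(\<Sum>i\<in>A. c i *\<^sub>R z i) = 0"
    then have "(\<Sum>i\<in>B. c (p i)) = 0" "(\<Sum>i\<in>B. c (p i) *\<^sub>R z (p i)) = 0"
      by (simp_all add: A sum.reindex[OF inj])
    then show "\<forall>i\<in>A. c i = 0" using h unfolding aff_indep_def A by auto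
  qed
  show "aff_indep (z \<circ> p) B" if h: "aff_indep z A"
    unfolding aff_indep_def
  proof (intro allI impI)
    fix c :: "'a \<Rightarrow> real"
    assume c: "(\<Sum>i\<in>B. c i) = 0" "(\<Sum>i\<in>B. c i *\<^sub>R (z \<circ> p) i) = 0"
    have "(\<Sum>i\<in>A. c (inv_into B p i)) = 0" "(\<Sum>i\<in>A. c (inv_into B p i) *\<^sub>R z i) = 0"
      using c by (simp_all add: A sum.reindex[OF inj] inv_into_f_f[OF inj])
    then have "\<forall>i\<in>A. c (inv_into B p i) = 0" 
      using h[unfolded aff_indep_def, rule_format, of "\<lambda>i. c (inv_into B p i)"] by blast
    then show "\<forall>i\<in>B. c i = 0" using inv_into_f_f[OF inj] A by auto
  qed
qed

lemma left_kernel_edge_matrix: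
  "c v* edge_matrix p x = c $ undefined *\<^sub>R x + (\<Sum>r\<in>UNIV - {undefined}. c $ r *\<^sub>R (p r - p undefined))"
proof -
  have "c v* edge_matrix p x = (\<Sum>r\<in>UNIV. c $ r *\<^sub>R (if r = undefined then x else p r - p undefined))"
    by (simp add: vec_eq_iff vector_matrix_mult_def edge_matrix_def sum_component mult.commute)
  also have "\<dots> = c $ undefined *\<^sub>R x + (\<Sum>r\<in>UNIV - {undefined}. c $ r *\<^sub>R (if r = undefined then x else p r - p undefined))"
    by (subst sum.remove[of _ undefined]) auto
  also have "(\<Sum>r\<in>UNIV - {undefined}. c $ r *\<^sub>R (if r = undefined then x else p r - p undefined))
     = (\<Sum>r\<in>UNIV - {undefined}. c $ r *\<^sub>R (p r - p undefined))"
    by (rule sum.cong) auto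
  finally show ?thesis .
qed

lemma det_zero_iff_left_kernel:
  fixes A :: "real ^ 'k ^ 'k"
  shows "det A = 0 \<longleftrightarrow> (\<exists>c. c \<noteq> 0 \<and> c v* A = 0)"
proof -
  have "det A = 0 \<longleftrightarrow> \<not> inj ((*v) (transpose A))"
    using det_nz_iff_inj[of "(*v) (transpose A)"] by (auto simp: det_transpose)
  also have "\<dots> \<longleftrightarrow> (\<exists>c. c \<noteq> 0 \<and> transpose A *v c = 0)"
    using linear_injective_0[of "(*v) (transpose A)"] by auto
  finally show ?thesis by simp
qed


lemma normal_nonzero:
  fixes p :: "'k::finite \<Rightarrow> real ^ 'k"
  assumes "aff_indep p UNIV"
  shows "normal p \<noteq> 0"
proof
  assume n: "normal p = 0"
  let ?S = "span ((\<lambda>r. p r - p undefined) ` (UNIV - {undefined}))"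
  have "dim ?S \<le> card ((\<lambda>r. p r - p undefined) ` (UNIV - {undefined}))"
    by (simp add: dim_le_card')
  also have "\<dots> \<le> card (UNIV - {undefined :: 'k})" by (rule card_image_le) simp
  also have "\<dots> < CARD('k)" by (simp add: card_Diff_singleton)
  finally have "?S \<noteq> UNIV" by (metis dim_UNIV DIM_cart DIM_real mult.right_neutral less_irrefl)
  then obtain x where x: "x \<notin> ?S" by auto
  have "det (edge_matrix p x) = 0" using n by (simp flip: normal_inner)
  then obtain c where c: "c \<noteq> 0" "c v* edge_matrix p x = 0"
    unfolding det_zero_iff_left_kernel by auto
  let ?s = "\<Sum>r\<in>UNIV - {undefined}. c $ r *\<^sub>R (p r - p undefined)"
  have s: "?s \<in> ?S"
    by (intro span_sum span_scale span_base) auto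
  have eq: "c $ undefined *\<^sub>R x + ?s = 0"
    using c by (simp add: left_kernel_edge_matrix)
  have c0: "c $ undefined = 0"
  proof (rule ccontr)
    assume nz: "c $ undefined \<noteq> 0"
    have "x = (- inverse (c $ undefined)) *\<^sub>R ?s"
    proof -
      have "x = inverse (c $ undefined) *\<^sub>R (c $ undefined *\<^sub>R x)" using nz by simp
      also have "c $ undefined *\<^sub>R x = - ?s" using eq by (simp only: add_eq_0_iff2)
      finally show ?thesis by simp
    qed
    moreover have "(- inverse (c $ undefined)) *\<^sub>R ?s \<in> ?S" using s by (rule span_scale)
    ultimately show False using x by (simp only: not_True_eq_False)
  qed
  define b where "b = (\<lambda>r. if r = undefined then - (\<Sum>r\<in>UNIV - {undefined}. c $ r) else c $ r)"
  have "(\<Sum>r\<in>UNIV. b r) = b undefined + (\<Sum>r\<in>UNIV - {undefined}. c $ r)"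
    by (subst sum.remove[of _ undefined]) (auto simp: b_def intro!: sum.cong)
  then have b1: "(\<Sum>r\<in>UNIV. b r) = 0" by (simp add: b_def)
  have "(\<Sum>r\<in>UNIV. b r *\<^sub>R p r) = b undefined *\<^sub>R p undefined + (\<Sum>r\<in>UNIV - {undefined}. c $ r *\<^sub>R p r)"
    by (subst sum.remove[of _ undefined]) (auto simp: b_def intro!: sum.cong)
  also have "\<dots> = ?s"
    by (simp add: b_def scaleR_right_diff_distrib sum_subtractf scaleR_sum_left)
  finally have b2: "(\<Sum>r\<in>UNIV. b r *\<^sub>R p r) = 0" using eq c0 by simp
  have b0: "b r = 0" for r using assms b1 b2 unfolding aff_indep_def by auto
  have "c $ r = 0" for r using c0 b0[of r] by (cases "r = undefined") (auto simp: b_def split: if_splits)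
  then show False using c(1) by (simp add: vec_eq_iff)
qed

lemma aff_indep_insert_iff:
  fixes p :: "'k::finite \<Rightarrow> 'i" and z :: "'i \<Rightarrow> real ^ 'k"
  assumes inj: "inj p" and w: "w \<notin> range p"
  shows "aff_indep z (insert w (range p)) \<longleftrightarrow> normal (z \<circ> p) \<bullet> (z w - z (p undefined)) \<noteq> 0"
proof -
  define k0 :: 'k where "k0 = undefined"
  let ?A = "edge_matrix (z \<circ> p) (z w - z (p undefined))"
  have sum_ins: "(\<Sum>i\<in>insert w (range p). g i) = g w + (g (p k0) + (\<Sum>r\<in>UNIV - {k0}. g (p r)))"
    for g :: "'i \<Rightarrow> 'b::comm_monoid_add"
    using w by (simp add: sum.reindex[OF inj] sum.remove[of UNIV k0])
  have ker: "c v* ?A = c $ k0 *\<^sub>R z w - (c $ k0 + (\<Sum>r\<in>UNIV - {k0}. c $ r)) *\<^sub>R z (p k0)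
      + (\<Sum>r\<in>UNIV - {k0}. c $ r *\<^sub>R z (p r))" for c
    by (simp add: left_kernel_edge_matrix k0_def scaleR_right_diff_distrib sum_subtractf scaleR_sum_left
        algebra_simps)
  have "\<not> aff_indep z (insert w (range p)) \<longleftrightarrow> (\<exists>c. c \<noteq> 0 \<and> c v* ?A = 0)"
  proof
    assume "\<not> aff_indep z (insert w (range p))"
    then obtain b where b: "(\<Sum>i\<in>insert w (range p). b i) = 0"
      "(\<Sum>i\<in>insert w (range p). b i *\<^sub>R z i) = 0" "\<exists>i\<in>insert w (range p). b i \<noteq> 0"
      unfolding aff_indep_def by auto
    define c where "c = (\<chi> r. if r = k0 then b w else b (p r))"
    have s: "(\<Sum>r\<in>UNIV - {k0}. c $ r) = (\<Sum>r\<in>UNIV - {k0}. b (p r))"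
      "(\<Sum>r\<in>UNIV - {k0}. c $ r *\<^sub>R z (p r)) = (\<Sum>r\<in>UNIV - {k0}. b (p r) *\<^sub>R z (p r))"
      by (auto simp: c_def intro!: sum.cong)
    have bk: "b (p k0) = - (b w + (\<Sum>r\<in>UNIV - {k0}. b (p r)))"
      using b(1) unfolding sum_ins by linarith
    have "c v* ?A = 0"
      using b(2) unfolding sum_ins ker s bk by (simp add: c_def algebra_simps)
    moreover have "c \<noteq> 0"
    proof
      assume "c = 0"
      then have c: "c $ r = 0" for r by simp
      have "b w = 0" using c[of k0] by (simp add: c_def)
      moreover have "b (p r) = 0" if "r \<noteq> k0" for r using c[of r] that by (simp add: c_def)
      ultimately have "b (p r) = 0" for r
        using bk by (cases "r = k0") simp_all
      with \<open>b w = 0\<close> b(3) show False by auto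
    qed
    ultimately show "\<exists>c. c \<noteq> 0 \<and> c v* ?A = 0" by blast
  next
    assume "\<exists>c. c \<noteq> 0 \<and> c v* ?A = 0"
    then obtain c where c: "c \<noteq> 0" "c v* ?A = 0" by blast
    define b where "b = (\<lambda>i. if i = w then c $ k0 else if i = p k0
      then - (c $ k0 + (\<Sum>r\<in>UNIV - {k0}. c $ r)) else c $ (the_inv p i))"
    have bw: "b w = c $ k0" by (simp add: b_def)
    have bk: "b (p k0) = - (c $ k0 + (\<Sum>r\<in>UNIV - {k0}. c $ r))"
      using w by (auto simp: b_def)
    have br: "b (p r) = c $ r" if "r \<noteq> k0" for r
      using w that inj by (auto simp: b_def the_inv_f_f inj_eq)
    have "(\<Sum>i\<in>insert w (range p). b i) = 0"
      unfolding sum_ins by (simp add: bw bk br)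
    moreover have "(\<Sum>i\<in>insert w (range p). b i *\<^sub>R z i) = 0"
      using c(2) unfolding sum_ins ker by (simp add: bw bk br algebra_simps)
    moreover have "\<exists>i\<in>insert w (range p). b i \<noteq> 0"
    proof -
      obtain r where "c $ r \<noteq> 0" using c(1) by (auto simp: vec_eq_iff)
      then have "b w \<noteq> 0 \<or> b (p r) \<noteq> 0" using bw br[of r] by (cases "r = k0") simp_all
      then show ?thesis by blast
    qed
    ultimately show "\<not> aff_indep z (insert w (range p))"
      unfolding aff_indep_def by blast
  qed
  then show ?thesis
    unfolding normal_inner det_zero_iff_left_kernel[symmetric] by auto
qed

lemma cayley_menger_aff_indep:
  fixes p :: "'k::finite \<Rightarrow> 'v" and x :: "'k \<Rightarrow> 'a::euclidean_space"
  assumes cm: "cayley_menger d p \<noteq> 0"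
    and d: "\<And>a b. a \<noteq> b \<Longrightarrow> d {p a, p b} = dist (x a) (x b)"
  shows "aff_indep x UNIV"
  unfolding aff_indep_def
proof (intro allI impI ballI, rule ccontr)
  fix c :: "'k \<Rightarrow> real" and i0
  assume c: "(\<Sum>i\<in>UNIV. c i) = 0" "(\<Sum>i\<in>UNIV. c i *\<^sub>R x i) = 0" and nz: "c i0 \<noteq> 0"
  define A :: "real ^ 'k option ^ 'k option" where "A = (\<chi> i j. case i of
       None \<Rightarrow> (case j of None \<Rightarrow> 0 | Some b \<Rightarrow> 1)
     | Some a \<Rightarrow> (case j of None \<Rightarrow> 1
                        | Some b \<Rightarrow> if a = b then 0 else (d {p a, p b})\<^sup>2))"
  define s where "s = (\<Sum>b\<in>UNIV. c b * (x b \<bullet> x b))"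
  define v :: "real ^ 'k option" where "v = (\<chi> i. case i of None \<Rightarrow> - s | Some a \<Rightarrow> c a)"
  have sq: "(\<Sum>b\<in>UNIV. (dist (x a) (x b))\<^sup>2 * c b) = s" for a
  proof -
    have "(dist (x a) (x b))\<^sup>2 * c b = (x a \<bullet> x a) * c b - 2 * (x a \<bullet> (c b *\<^sub>R x b)) + c b * (x b \<bullet> x b)" for b
      by (simp add: dist_norm power2_norm_eq_inner inner_diff_left inner_diff_right inner_commute algebra_simps)
    then have "(\<Sum>b\<in>UNIV. (dist (x a) (x b))\<^sup>2 * c b) =
       (x a \<bullet> x a) * (\<Sum>b\<in>UNIV. c b) - 2 * (x a \<bullet> (\<Sum>b\<in>UNIV. c b *\<^sub>R x b)) + s"
      by (simp only: sum.distrib sum_subtractf s_def sum_distrib_left inner_sum_right)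
    then show ?thesis using c by simp
  qed
  have opt: "(\<Sum>j\<in>UNIV. g j) = g None + (\<Sum>b\<in>UNIV. g (Some b))" for g :: "'k option \<Rightarrow> real"
    by (simp add: UNIV_option_conv sum.reindex)
  have "A *v v = 0"
  proof (subst vec_eq_iff, rule allI)
    fix i
    show "(A *v v) $ i = 0 $ i"
    proof (cases i)
      case None
      then show ?thesis using c(1)
        by (simp add: matrix_vector_mult_def opt A_def v_def)
    next
      case (Some a)
      have "(\<Sum>b\<in>UNIV. (if a = b then 0 else (d {p a, p b})\<^sup>2) * c b) = (\<Sum>b\<in>UNIV. (dist (x a) (x b))\<^sup>2 * c b)"
        by (rule sum.cong) (auto simp: d)
      then show ?thesis using Some sq[of a]
        by (simp add: matrix_vector_mult_def opt A_def v_def)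
    qed
  qed
  moreover have "v \<noteq> 0" using nz by (auto simp: vec_eq_iff v_def split: option.splits intro!: exI[of _ "Some i0"])
  moreover have "invertible A" using cm by (simp add: invertible_det_nz A_def cayley_menger_def)
  ultimately show False
    using inj_matrix_vector_mult by (metis injD matrix_vector_mult_0_right)
qed

section \<open>Embeddings as sequences of reflections of a generic one\<close>

definition idx :: "'k::finite \<Rightarrow> nat" where
  "idx = (SOME f. bij_betw f UNIV {..<CARD('k)})"

lemma bij_betw_idx: "bij_betw (idx :: 'k::finite \<Rightarrow> nat) UNIV {..<CARD('k)}"
proof -
  have "\<exists>f :: 'k \<Rightarrow> nat. bij_betw f UNIV {..<CARD('k)}"
    using ex_bij_betw_finite_nat[of "UNIV :: 'k set"] by (simp add: lessThan_atLeast0)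
  then show ?thesis unfolding idx_def by (rule someI_ex)
qed

definition window :: "nat \<Rightarrow> 'k::finite \<Rightarrow> nat" where
  "window i k = i - CARD('k) + idx k"

lemma bij_betw_window:
  assumes "CARD('k::finite) \<le> i"
  shows "bij_betw (window i :: 'k \<Rightarrow> nat) UNIV {i - CARD('k)..<i}"
proof -
  have "bij_betw (\<lambda>j. i - CARD('k) + j) {..<CARD('k)} {i - CARD('k)..<i}"
    by (rule bij_betw_byWitness[where f' = "\<lambda>j. j - (i - CARD('k))"]) (use assms in auto)
  from bij_betw_trans[OF bij_betw_idx this] show ?thesis
    by (simp add: comp_def window_def[abs_def])
qed

lemma window_less:
  assumes "CARD('k) \<le> i"
  shows "window i (k :: 'k::finite) < i"
  using bij_betw_apply[OF bij_betw_window[OF assms], of k] by simp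

definition window_mirror :: "(nat \<Rightarrow> real ^ 'k::finite) \<Rightarrow> nat \<Rightarrow> real ^ 'k \<Rightarrow> real ^ 'k" where
  "window_mirror z i = mirror (z \<circ> window i)"

lemma window_mirror_cong:
  fixes z z' :: "nat \<Rightarrow> real ^ 'k"
  assumes "CARD('k) \<le> i" "\<And>j. j < i \<Longrightarrow> z j = z' j"
  shows "window_mirror z i = window_mirror z' i"
proof -
  have "z \<circ> window i = z' \<circ> (window i :: 'k \<Rightarrow> nat)"
    using assms window_less[OF assms(1)] by auto
  then show ?thesis by (simp add: window_mirror_def)
qed

lemma fold_window_mirror_cong:
  fixes z z' :: "nat \<Rightarrow> real ^ 'k"
  assumes "set vs \<subseteq> {CARD('k)..w}" "\<And>j. j < w \<Longrightarrow> z j = z' j"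
  shows "fold (window_mirror z) vs x = fold (window_mirror z') vs x"
proof (rule fold_cong)
  fix v assume "v \<in> set vs"
  then have "CARD('k) \<le> v" "v \<le> w" using assms(1) by auto
  then show "window_mirror z v = window_mirror z' v"
    using assms(2) by (intro window_mirror_cong) auto
qed simp_all

locale generic_sequence =
  fixes z :: "nat \<Rightarrow> real ^ 'k" and n :: nat
  assumes window_indep: "\<And>i. CARD('k) \<le> i \<Longrightarrow> i < n \<Longrightarrow> aff_indep z {i - CARD('k)..<i}"
    and off_hyperplane: "\<And>(p :: 'k \<Rightarrow> nat) w. CARD('k) \<le> w \<Longrightarrow> w < n \<Longrightarrow> range p \<subseteq> {..<w} \<Longrightarrow>
      normal (z \<circ> p) \<noteq> 0 \<Longrightarrow> normal (z \<circ> p) \<bullet> (z w - z (p undefined)) \<noteq> 0"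
    and not_equidistant: "\<And>vs u w. CARD('k) \<le> w \<Longrightarrow> w < n \<Longrightarrow> u < w \<Longrightarrow> set vs \<subseteq> {CARD('k)..w} \<Longrightarrow>
      fold (window_mirror z) vs (z u) \<noteq> z u \<Longrightarrow>
      dist (z w) (fold (window_mirror z) vs (z u)) \<noteq> dist (z w) (z u)"
begin

abbreviation R :: "nat \<Rightarrow> real ^ 'k \<Rightarrow> real ^ 'k" where
  "R \<equiv> window_mirror z"

lemma R_fixes:
  assumes "CARD('k) \<le> i" "j < i" "i \<le> j + CARD('k)"
  shows "R i (z j) = z j"
proof -
  have "j \<in> {i - CARD('k)..<i}" using assms by auto
  then obtain r :: 'k where "j = window i r"
    using bij_betw_window[OF assms(1)] unfolding bij_betw_def by blast
  then show ?thesis using mirror_fixes[of "z \<circ> window i" r] by (simp add: window_mirror_def)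
qed

lemma R_R: "R i (R i x) = x"
  by (simp add: window_mirror_def mirror_mirror)

lemma dist_R: "dist (R i x) (R i y) = dist x y"
  by (simp add: window_mirror_def dist_mirror)

lemma dist_foldr_R: "dist (foldr R xs x) (foldr R xs y) = dist x y"
  by (induction xs) (simp_all add: dist_R)

lemma foldr_R_inject: "foldr R xs x = foldr R xs y \<longleftrightarrow> x = y"
  using dist_foldr_R[of xs x y] by (metis dist_eq_0_iff)

lemma foldr_fold_R: "foldr R xs (fold R xs x) = x"
  by (induction xs arbitrary: x) (simp_all add: R_R)

lemma normal_window:
  assumes "CARD('k) \<le> i" "i < n"
  shows "normal (z \<circ> window i) \<noteq> 0"
  using window_indep[OF assms] unfolding aff_indep_reindex[OF bij_betw_window[where 'k='k, OF assms(1)]]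
  by (rule normal_nonzero)

lemma aff_indep_insert:
  assumes w: "CARD('k) \<le> w" "w < n" and A: "A \<subseteq> {..<w}" "card A = CARD('k)" "aff_indep z A"
  shows "aff_indep z (insert w A)"
proof -
  have "finite A" using A(1) finite_subset by blast
  then obtain p :: "'k \<Rightarrow> nat" where p: "bij_betw p UNIV A"
    using A(2) by (metis finite_same_card_bij finite)
  then have "normal (z \<circ> p) \<noteq> 0"
    using A(3) unfolding aff_indep_reindex[OF p] by (intro normal_nonzero)
  then have "normal (z \<circ> p) \<bullet> (z w - z (p undefined)) \<noteq> 0"
    using p A(1) w by (intro off_hyperplane) (auto simp: bij_betw_def)
  then show ?thesis
    using p A(1) aff_indep_insert_iff[of p w z] by (auto simp: bij_betw_def)
qed

lemma aff_indep_vertex_window: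
  assumes "u + CARD('k) < v" "v \<le> n"
  shows "aff_indep z (insert u {v - CARD('k)..<v})"
proof -
  have "Suc (u + CARD('k)) \<le> v" using assms by simp
  then show ?thesis using assms(2)
  proof (induction v rule: dec_induct)
    case base
    have "aff_indep z (insert (u + CARD('k)) {u..<u + CARD('k)})"
      by (rule aff_indep_insert) (use base window_indep[of "u + CARD('k)"] in auto)
    moreover have "insert (u + CARD('k)) {u..<u + CARD('k)} = insert u {Suc (u + CARD('k)) - CARD('k)..<Suc (u + CARD('k))}" by auto
    ultimately show ?case by simp
  next
    case (step v)
    let ?A = "insert u {Suc v - CARD('k)..<v}"
    have K: "0 < CARD('k)" by simp
    have "aff_indep z ?A"
      by (rule aff_indep_subset[of z "insert u {v - CARD('k)..<v}"]) (use step in auto)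
    moreover have "u \<notin> {Suc v - CARD('k)..<v}" using step(1) by auto
    then have "card ?A = Suc (v - (Suc v - CARD('k)))" by simp
    then have "card ?A = CARD('k)" using step(1) K by linarith
    ultimately have "aff_indep z (insert v ?A)"
      by (intro aff_indep_insert[of v ?A]) (use step in auto)
    moreover have "Suc v - CARD('k) \<le> v" using K by linarith
    then have "insert v ?A = insert u {Suc v - CARD('k)..<Suc v}"
      by (simp add: atLeastLessThanSuc insert_commute)
    ultimately show ?case by simp
  qed
qed

lemma R_moves:
  assumes "CARD('k) \<le> v" "v < n" "u \<notin> {v - CARD('k)..<v}" "aff_indep z (insert u {v - CARD('k)..<v})"
  shows "R v (z u) \<noteq> z u"
proof -
  have "bij_betw (window v :: 'k \<Rightarrow> nat) UNIV {v - CARD('k)..<v}" by (rule bij_betw_window[OF assms(1)])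
  then have "normal (z \<circ> window v) \<bullet> (z u - z (window v (undefined :: 'k))) \<noteq> 0"
    using aff_indep_insert_iff[of "window v" u z] assms(3,4) by (auto simp: bij_betw_def)
  then show ?thesis
    using mirror_eq_iff[OF normal_window[OF assms(1,2)], of "z u"] by (simp add: window_mirror_def)
qed

lemma fold_R_moves:
  assumes "sorted_wrt (<) xs" "xs \<noteq> []" "set xs \<subseteq> {u + CARD('k)<..<n}"
  shows "fold R xs (z u) \<noteq> z u"
  using assms
proof (induction xs rule: rev_induct)
  case (snoc v xs)
  have v: "u + CARD('k) < v" "v < n" using snoc.prems by auto
  show ?case
  proof (cases "xs = []")
    case True
    then show ?thesis using R_moves[of v u] aff_indep_vertex_window[of u v] v by auto
  next
    case False
    let ?q = "fold R xs (z u)"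
    have q: "?q \<noteq> z u" using snoc False by (auto simp: sorted_wrt_append)
    have lt: "\<forall>x\<in>set xs. x < v \<and> u + CARD('k) < x" using snoc.prems by (auto simp: sorted_wrt_append)
    then have "hd xs < v" "u + CARD('k) < hd xs" using False by auto
    then have Kv: "u + CARD('k) < v - 1" by linarith
    show ?thesis
    proof
      assume "fold R (xs @ [v]) (z u) = z u"
      then have "R v ?q = z u" by simp
      moreover have "R v (z (v - 1)) = z (v - 1)" using Kv zero_less_card_finite[where 'a='k] by (intro R_fixes) linarith+
      ultimately have "dist (z (v - 1)) ?q = dist (z (v - 1)) (z u)"
        using dist_R[of v "z (v - 1)" ?q] by simp
      moreover have "set xs \<subseteq> {CARD('k)..v - 1}" using lt by fastforce
      ultimately show False using not_equidistant[of "v - 1" u xs] q Kv v by (simp add: less_imp_diff_less)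
    qed
  qed
qed simp

text \<open>\<open>S\<close> records at which vertices \<open>y\<close> takes the mirror image instead of the position of \<open>z\<close>.\<close>
definition flips :: "(nat \<Rightarrow> real ^ 'k) \<Rightarrow> nat set \<Rightarrow> nat \<Rightarrow> bool" where
  "flips y S m \<longleftrightarrow> (\<forall>w<m. y w = foldr R (filter (\<lambda>i. i \<in> S) [CARD('k)..<Suc w]) (z w))"

lemma foldr_R_extend:
  assumes "j \<le> i" "i \<le> j + CARD('k)"
  shows "foldr R (filter (\<lambda>i. i \<in> S) [CARD('k)..<Suc i]) (z j) = foldr R (filter (\<lambda>i. i \<in> S) [CARD('k)..<Suc j]) (z j)"
  using assms
proof (induction i rule: dec_induct)
  case (step i)
  show ?case
  proof (cases "CARD('k) \<le> Suc i \<and> Suc i \<in> S")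
    case True
    then have "R (Suc i) (z j) = z j" using step by (intro R_fixes) auto
    then show ?thesis using step True by simp
  next
    case False
    then have "filter (\<lambda>i. i \<in> S) [CARD('k)..<Suc (Suc i)] = filter (\<lambda>i. i \<in> S) [CARD('k)..<Suc i]" by auto
    then show ?thesis using step by simp
  qed
qed simp

lemma flips_exist:
  assumes init: "\<And>i. i < CARD('k) \<Longrightarrow> i < n \<Longrightarrow> y i = z i"
    and dist: "\<And>i j. CARD('k) \<le> i \<Longrightarrow> i < n \<Longrightarrow> j < i \<Longrightarrow> i \<le> j + CARD('k) \<Longrightarrow> dist (y i) (y j) = dist (z i) (z j)"
  obtains S where "flips y S n"
proof -
  have "\<exists>S. flips y S m" if "m \<le> n" for m
    using that
  proof (induction m)
    case 0
    show ?case by (simp add: flips_def)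
  next
    case (Suc m)
    then obtain S where S: "flips y S m" by auto
    show ?case
    proof (cases "m < CARD('k)")
      case True
      then show ?thesis using S init[of m] Suc.prems by (auto simp: flips_def less_Suc_eq)
    next
      case False
      let ?P = "filter (\<lambda>i. i \<in> S) [CARD('k)..<m]"
      define a where "a = fold R ?P (y m)"
      have a: "foldr R ?P a = y m"
        by (simp add: a_def foldr_fold_R)
      have "dist a ((z \<circ> window m) r) = dist (z m) ((z \<circ> window m) r)" for r :: 'k
      proof -
        define j where "j = window m r"
        have "j \<in> {m - CARD('k)..<m}"
          using bij_betw_apply[OF bij_betw_window[where 'k='k, of m]] False by (simp add: j_def)
        then have j: "j < m" "m \<le> j + CARD('k)" by auto
        have "y j = foldr R (filter (\<lambda>i. i \<in> S) [CARD('k)..<Suc j]) (z j)"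
          using S j by (simp add: flips_def)
        also have "\<dots> = foldr R (filter (\<lambda>i. i \<in> S) [CARD('k)..<Suc (m - 1)]) (z j)"
          by (rule foldr_R_extend[symmetric]) (use j in auto)
        finally have "y j = foldr R ?P (z j)" using j by simp
        then have "dist a (z j) = dist (y m) (y j)" using dist_foldr_R[of ?P a "z j"] a by simp
        also have "\<dots> = dist (z m) (z j)" using dist j False Suc.prems by simp
        finally show ?thesis by (simp add: j_def)
      qed
      then have "a = z m \<or> a = R m (z m)"
        unfolding window_mirror_def using False Suc.prems
        by (intro equidistant_imp_mirror normal_window) auto
      then obtain S' where S': "S' = (if a = z m then S - {m} else insert m S)"
        "a = (if m \<in> S' then R m (z m) else z m)" by auto
      have eq: "filter (\<lambda>i. i \<in> S') [CARD('k)..<Suc w] = filter (\<lambda>i. i \<in> S) [CARD('k)..<Suc w]" if "w < m" for w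
        using that S'(1) by (auto intro!: filter_cong)
      have "filter (\<lambda>i. i \<in> S') [CARD('k)..<m] = ?P"
        using S'(1) by (auto intro!: filter_cong)
      then have "y m = foldr R (filter (\<lambda>i. i \<in> S') [CARD('k)..<Suc m]) (z m)"
        using a S'(2) False by (auto split: if_splits)
      then have "flips y S' (Suc m)"
        using S eq by (auto simp: flips_def less_Suc_eq simp del: upt_Suc)
      then show ?thesis ..
    qed
  qed
  then show thesis using that by blast
qed

lemma flips_avoid_edge:
  assumes S: "flips y S n" and w: "u + CARD('k) < w" "w < n" and d: "dist (y u) (y w) = dist (z u) (z w)"
  shows "S \<inter> {u + CARD('k)<..w} = {}"
proof (rule ccontr)
  assume ne: "S \<inter> {u + CARD('k)<..w} \<noteq> {}"
  let ?P = "filter (\<lambda>i. i \<in> S) [CARD('k)..<Suc (u + CARD('k))]"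
  let ?Q = "filter (\<lambda>i. i \<in> S) [Suc (u + CARD('k))..<Suc w]"
  have "[CARD('k)..<Suc w] = [CARD('k)..<Suc (u + CARD('k))] @ [Suc (u + CARD('k))..<Suc w]"
    using upt_add_eq_append[of "CARD('k)" "Suc (u + CARD('k))" "w - (u + CARD('k))"] w by simp
  then have "y w = foldr R ?P (foldr R ?Q (z w))"
    using S w by (simp add: flips_def del: upt_Suc)
  moreover have "y u = foldr R ?P (z u)"
    using S w foldr_R_extend[of u "u + CARD('k)" S] by (simp add: flips_def)
  ultimately have "dist (foldr R ?Q (fold R ?Q (z u))) (foldr R ?Q (z w)) = dist (z u) (z w)"
    using d by (simp only: dist_foldr_R foldr_fold_R)
  then have "dist (z w) (fold R ?Q (z u)) = dist (z w) (z u)"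
    by (simp only: dist_foldr_R dist_commute)
  moreover have "?Q \<noteq> []" using ne by (auto simp: filter_empty_conv simp del: upt_Suc)
  then have "fold R ?Q (z u) \<noteq> z u"
    using w by (intro fold_R_moves) (auto simp: sorted_wrt_filter simp del: upt_Suc)
  moreover have "set ?Q \<subseteq> {CARD('k)..w}" by (auto simp del: upt_Suc)
  ultimately show False
    using not_equidistant[of w u ?Q] w by (simp del: upt_Suc)
qed

lemma flips_unique:
  assumes S: "flips y S n" and S': "flips y' S' n" and v: "v \<le> n" and eq: "\<And>j. j < v \<Longrightarrow> y' j = y j"
    and j: "CARD('k) \<le> j" "j < v"
  shows "j \<in> S \<longleftrightarrow> j \<in> S'"
  using j
proof (induction j rule: less_induct)
  case (less j)
  let ?P = "filter (\<lambda>i. i \<in> S) [CARD('k)..<j]"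
  have P: "filter (\<lambda>i. i \<in> S') [CARD('k)..<j] = ?P"
    by (rule filter_cong) (use less in auto)
  have "y j = foldr R ?P (if j \<in> S then R j (z j) else z j)"
    using S less v by (simp add: flips_def)
  moreover have "y' j = foldr R ?P (if j \<in> S' then R j (z j) else z j)"
    using S' less v P by (simp add: flips_def)
  ultimately have "(if j \<in> S then R j (z j) else z j) = (if j \<in> S' then R j (z j) else z j)"
    using eq[of j] less.prems by (simp only: foldr_R_inject)
  moreover have "R j (z j) \<noteq> z j"
  proof (rule R_moves)
    show "aff_indep z (insert j {j - CARD('k)..<j})"
      using less v by (intro aff_indep_insert[OF _ _ _ _ window_indep]) auto
  qed (use less v in auto)
  ultimately show ?case by (auto split: if_splits)
qed

theorem no_edge_across_branching:
  assumes y: "\<And>i. i < CARD('k) \<Longrightarrow> i < n \<Longrightarrow> y i = z i"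
      "\<And>i j. CARD('k) \<le> i \<Longrightarrow> i < n \<Longrightarrow> j < i \<Longrightarrow> i \<le> j + CARD('k) \<Longrightarrow> dist (y i) (y j) = dist (z i) (z j)"
    and y': "\<And>i. i < CARD('k) \<Longrightarrow> i < n \<Longrightarrow> y' i = z i"
      "\<And>i j. CARD('k) \<le> i \<Longrightarrow> i < n \<Longrightarrow> j < i \<Longrightarrow> i \<le> j + CARD('k) \<Longrightarrow> dist (y' i) (y' j) = dist (z i) (z j)"
    and branch: "\<And>j. j < v \<Longrightarrow> y' j = y j" "y' v \<noteq> y v"
    and uw: "u + CARD('k) < v" "v \<le> w" "w < n"
    and d: "dist (y u) (y w) = dist (z u) (z w)" "dist (y' u) (y' w) = dist (z u) (z w)"
  shows False
proof -
  obtain S where S: "flips y S n" using flips_exist[OF y] by blast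
  obtain S' where S': "flips y' S' n" using flips_exist[OF y'] by blast
  have "v \<notin> S" "v \<notin> S'"
    using flips_avoid_edge[OF S _ _ d(1)] flips_avoid_edge[OF S' _ _ d(2)] uw by auto
  moreover have "filter (\<lambda>i. i \<in> S) [CARD('k)..<v] = filter (\<lambda>i. i \<in> S') [CARD('k)..<v]"
    using flips_unique[OF S S', of v] branch(1) uw by (intro filter_cong) auto
  ultimately have "y v = y' v"
    using S S' uw by (simp add: flips_def)
  with branch(2) show False by simp
qed

end

section \<open>Genericity holds almost surely\<close>

lemma AE_lborel_not_equidistant:
  fixes a b :: "'a::euclidean_space"
  assumes "a \<noteq> b"
  shows "AE y in lborel. dist y a \<noteq> dist y b"
proof -
  have eq: "{y. dist y a = dist y b} = {y. (2 *\<^sub>R (b - a)) \<bullet> y = b \<bullet> b - a \<bullet> a}"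
    by (auto simp: dist_norm norm_eq_sqrt_inner inner_diff_left inner_diff_right inner_commute algebra_simps)
  have "{y. dist y a = dist y b} \<in> null_sets lebesgue"
    unfolding eq negligible_iff_null_sets[symmetric]
    by (rule negligible_hyperplane) (use assms in auto)
  moreover have "closed {y. dist y a = dist y b}"
    by (intro closed_Collect_eq continuous_intros)
  ultimately have "{y. dist y a = dist y b} \<in> null_sets lborel"
    by (subst (asm) null_sets_completion_iff) auto
  then show ?thesis by (rule AE_I') auto
qed

lemma AE_PiM_not_equidistant:
  fixes f g :: "('i \<Rightarrow> 'a::euclidean_space) \<Rightarrow> 'a"
  assumes I: "finite I" "i \<in> I"
    and f: "f \<in> borel_measurable (\<Pi>\<^sub>M i\<in>I. lborel)"
    and g: "g \<in> borel_measurable (\<Pi>\<^sub>M i\<in>I. lborel)"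
    and f_upd: "\<And>x y. f (x(i := y)) = f x" and g_upd: "\<And>x y. g (x(i := y)) = g x"
  shows "AE x in (\<Pi>\<^sub>M i\<in>I. lborel). f x \<noteq> g x \<longrightarrow> dist (x i) (f x) \<noteq> dist (x i) (g x)"
proof -
  interpret product_sigma_finite "\<lambda>_ :: 'i. lborel :: 'a measure" ..
  define P where "P = (\<Pi>\<^sub>M i\<in>I. (lborel :: 'a measure))"
  have xi[measurable]: "(\<lambda>x. x i) \<in> borel_measurable P"
    unfolding P_def using measurable_component_singleton[OF I(2), of "\<lambda>_. lborel :: 'a measure"] by simp
  have [measurable]: "f \<in> borel_measurable P" "g \<in> borel_measurable P"
    unfolding P_def by (rule f g)+
  define B where "B = {x \<in> space P. f x \<noteq> g x \<and> dist (x i) (f x) = dist (x i) (g x)}"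
  have "B = {x \<in> space P. dist (x i) (f x) = dist (x i) (g x)} - {x \<in> space P. f x = g x}"
    by (auto simp: B_def)
  then have B: "B \<in> sets P"
    by (simp only:) (intro sets.Diff measurable_equality_set; measurable)
  have ins: "insert i (I - {i}) = I" using I by auto
  have "emeasure P B = (\<integral>\<^sup>+ x. indicator B x \<partial>P)" using B by simp
  also have "\<dots> = (\<integral>\<^sup>+ x. (\<integral>\<^sup>+ y. indicator B (x(i := y)) \<partial>lborel) \<partial>(\<Pi>\<^sub>M i\<in>I - {i}. lborel))"
    unfolding P_def using I B
    by (subst product_nn_integral_insert[of "I - {i}" i, unfolded ins]) (auto simp: P_def)
  also have "\<dots> = (\<integral>\<^sup>+ x. 0 \<partial>(\<Pi>\<^sub>M i\<in>I - {i}. (lborel :: 'a measure)))"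
  proof (rule nn_integral_cong)
    fix x
    have "AE y in lborel. indicator B (x(i := y)) = (0 :: ennreal)"
    proof (cases "f x = g x")
      case True
      then show ?thesis by (auto simp: B_def f_upd g_upd)
    next
      case False
      show ?thesis using AE_lborel_not_equidistant[OF False]
        by eventually_elim (auto simp: B_def f_upd g_upd)
    qed
    then show "(\<integral>\<^sup>+ y. indicator B (x(i := y)) \<partial>lborel) = 0"
      by (subst nn_integral_cong_AE[where v = "\<lambda>_. 0"]) auto
  qed
  finally have "B \<in> null_sets P" using B by (auto simp: null_sets_def)
  then show ?thesis unfolding P_def[symmetric] by (rule AE_I') (auto simp: B_def)
qed

lemma borel_measurable_vec_iff:
  fixes f :: "'a \<Rightarrow> real ^ 'n"
  shows "f \<in> borel_measurable M \<longleftrightarrow> (\<forall>i. (\<lambda>x. f x $ i) \<in> borel_measurable M)"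
  by (subst borel_measurable_euclidean_space) (auto simp: Basis_vec_def inner_axis)

lemma borel_measurable_normal:
  fixes p :: "'a \<Rightarrow> 'k::finite \<Rightarrow> real ^ 'k"
  assumes "\<And>r. (\<lambda>x. p x r) \<in> borel_measurable M"
  shows "(\<lambda>x. normal (p x)) \<in> borel_measurable M"
proof -
  have [measurable]: "(\<lambda>x. p x r $ c) \<in> borel_measurable M" for r c
    using assms[of r] by (simp add: borel_measurable_vec_iff)
  have [measurable]: "(\<lambda>x. edge_matrix (p x) a $ r $ c) \<in> borel_measurable M" for a r c
    by (cases "r = undefined") (simp_all add: edge_matrix_def)
  show ?thesis
    unfolding borel_measurable_vec_iff normal_def det_def by simp
qed

lemma borel_measurable_mirror:
  fixes p :: "'a \<Rightarrow> 'k::finite \<Rightarrow> real ^ 'k"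
  assumes [measurable]: "\<And>r. (\<lambda>x. p x r) \<in> borel_measurable M" "f \<in> borel_measurable M"
  shows "(\<lambda>x. mirror (p x) (f x)) \<in> borel_measurable M"
proof -
  note borel_measurable_normal[OF assms(1), measurable]
  show ?thesis unfolding mirror_def by measurable
qed

lemma borel_measurable_fold_window_mirror:
  fixes z :: "'a \<Rightarrow> nat \<Rightarrow> real ^ 'k"
  assumes z: "\<And>j. j < w \<Longrightarrow> (\<lambda>x. z x j) \<in> borel_measurable M"
    and "f \<in> borel_measurable M" "set vs \<subseteq> {CARD('k)..w}"
  shows "(\<lambda>x. fold (window_mirror (z x)) vs (f x)) \<in> borel_measurable M"
  using assms(2-)
proof (induction vs arbitrary: f)
  case (Cons v vs)
  then have "CARD('k) \<le> v" "v \<le> w" by auto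
  then have "(\<lambda>x. z x (window v (r :: 'k))) \<in> borel_measurable M" for r
    using window_less[of v r] by (intro z) linarith
  then have "(\<lambda>x. window_mirror (z x) v (f x)) \<in> borel_measurable M"
    unfolding window_mirror_def by (intro borel_measurable_mirror Cons.prems) (simp add: comp_def)
  then show ?case using Cons by simp
qed simp

definition config :: "(nat \<Rightarrow> real ^ 'k) \<Rightarrow> (nat \<Rightarrow> 'v) \<Rightarrow> ('v \<Rightarrow> real ^ 'k) \<Rightarrow> nat \<Rightarrow> real ^ 'k" where
  "config x0 s \<zeta> j = (if j < CARD('k) then x0 j else \<zeta> (s j))"

context
  fixes x0 :: "nat \<Rightarrow> real ^ 'k" and s :: "nat \<Rightarrow> 'v" and n :: nat and P :: "('v \<Rightarrow> real ^ 'k) measure"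
  assumes inj: "inj_on s {..<n}"
  defines "P \<equiv> (\<Pi>\<^sub>M i\<in>s ` {CARD('k)..<n}. lborel)"
begin

lemma config_upd: "w < n \<Longrightarrow> j < w \<Longrightarrow> config x0 s (\<zeta>(s w := a)) j = config x0 s \<zeta> j"
  using inj_onD[OF inj, of j w] by (auto simp: config_def)

lemma borel_measurable_config: "j < n \<Longrightarrow> (\<lambda>\<zeta>. config x0 s \<zeta> j) \<in> borel_measurable P"
  unfolding config_def P_def
  using measurable_component_singleton[of "s j" "s ` {CARD('k)..<n}" "\<lambda>_. lborel :: (real ^ 'k) measure"]
  by (cases "j < CARD('k)") auto

lemma AE_config_off_hyperplane:
  fixes p :: "'k \<Rightarrow> nat"
  assumes w: "CARD('k) \<le> w" "w < n" and p: "range p \<subseteq> {..<w}"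
  shows "AE \<zeta> in P. normal (config x0 s \<zeta> \<circ> p) \<noteq> 0 \<longrightarrow>
    normal (config x0 s \<zeta> \<circ> p) \<bullet> (config x0 s \<zeta> w - config x0 s \<zeta> (p undefined)) \<noteq> 0"
proof -
  define N where "N = (\<lambda>\<zeta>. normal (config x0 s \<zeta> \<circ> p))"
  \<comment> \<open>The hyperplane through \<open>Q\<close> with normal \<open>N\<close> is the bisector of \<open>Q + N\<close> and \<open>Q - N\<close>.\<close>
  define Q where "Q = (\<lambda>\<zeta>. config x0 s \<zeta> (p undefined))"
  have pw: "p r < w" for r using p by auto
  have [measurable]: "N \<in> borel_measurable P" "Q \<in> borel_measurable P"
    unfolding N_def Q_def using pw w
    by (auto intro!: borel_measurable_normal borel_measurable_config simp: comp_def intro: less_trans)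
  have "AE \<zeta> in P. Q \<zeta> + N \<zeta> \<noteq> Q \<zeta> - N \<zeta> \<longrightarrow> dist (\<zeta> (s w)) (Q \<zeta> + N \<zeta>) \<noteq> dist (\<zeta> (s w)) (Q \<zeta> - N \<zeta>)"
    unfolding P_def
  proof (rule AE_PiM_not_equidistant)
    fix \<zeta> a
    have "config x0 s (\<zeta>(s w := a)) \<circ> p = config x0 s \<zeta> \<circ> p"
      using config_upd[OF w(2) pw] by auto
    then show "Q (\<zeta>(s w := a)) + N (\<zeta>(s w := a)) = Q \<zeta> + N \<zeta>"
      "Q (\<zeta>(s w := a)) - N (\<zeta>(s w := a)) = Q \<zeta> - N \<zeta>"
      by (simp_all add: N_def Q_def config_upd[OF w(2) pw])
  qed (use w in \<open>auto simp flip: P_def\<close>)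
  then show ?thesis
  proof eventually_elim
    case (elim \<zeta>)
    show ?case
    proof (intro impI notI)
      assume n: "normal (config x0 s \<zeta> \<circ> p) \<noteq> 0"
        and z: "normal (config x0 s \<zeta> \<circ> p) \<bullet> (config x0 s \<zeta> w - config x0 s \<zeta> (p undefined)) = 0"
      have "N \<zeta> \<noteq> - N \<zeta>" using n
        by (simp add: N_def eq_neg_iff_add_eq_0 flip: scaleR_2)
      then have "Q \<zeta> + N \<zeta> \<noteq> Q \<zeta> - N \<zeta>" by (simp only: add_left_cancel diff_conv_add_uminus not_False_eq_True)
      moreover have "N \<zeta> \<bullet> (\<zeta> (s w) - Q \<zeta>) = 0"
        using z w by (simp add: N_def Q_def config_def[of _ _ _ w])
      then have "dist (\<zeta> (s w)) (Q \<zeta> + N \<zeta>) = dist (\<zeta> (s w)) (Q \<zeta> - N \<zeta>)"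
        by (simp add: dist_norm norm_eq_sqrt_inner inner_diff_left inner_diff_right inner_add_left
            inner_add_right inner_commute algebra_simps)
      ultimately show False using elim by blast
    qed
  qed
qed

lemma AE_config_not_equidistant:
  assumes w: "CARD('k) \<le> w" "w < n" and u: "u < w" and vs: "set vs \<subseteq> {CARD('k)..w}"
  shows "AE \<zeta> in P.
    fold (window_mirror (config x0 s \<zeta>)) vs (config x0 s \<zeta> u) \<noteq> config x0 s \<zeta> u \<longrightarrow>
    dist (config x0 s \<zeta> w) (fold (window_mirror (config x0 s \<zeta>)) vs (config x0 s \<zeta> u)) \<noteq>
    dist (config x0 s \<zeta> w) (config x0 s \<zeta> u)"
proof -
  have "config x0 s \<zeta> w = \<zeta> (s w)" for \<zeta> using w by (simp add: config_def)
  moreover have "AE \<zeta> in P.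
    fold (window_mirror (config x0 s \<zeta>)) vs (config x0 s \<zeta> u) \<noteq> config x0 s \<zeta> u \<longrightarrow>
    dist (\<zeta> (s w)) (fold (window_mirror (config x0 s \<zeta>)) vs (config x0 s \<zeta> u)) \<noteq>
    dist (\<zeta> (s w)) (config x0 s \<zeta> u)"
    unfolding P_def
  proof (rule AE_PiM_not_equidistant, fold P_def)
    fix \<zeta> a
    show "fold (window_mirror (config x0 s (\<zeta>(s w := a)))) vs (config x0 s (\<zeta>(s w := a)) u) =
      fold (window_mirror (config x0 s \<zeta>)) vs (config x0 s \<zeta> u)"
      using fold_window_mirror_cong[OF vs, of "config x0 s (\<zeta>(s w := a))" "config x0 s \<zeta>"]
        config_upd[OF w(2)] u by simp
    show "config x0 s (\<zeta>(s w := a)) u = config x0 s \<zeta> u"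
      by (rule config_upd[OF w(2) u])
    show "(\<lambda>\<zeta>. fold (window_mirror (config x0 s \<zeta>)) vs (config x0 s \<zeta> u)) \<in> borel_measurable P"
      by (rule borel_measurable_fold_window_mirror[OF _ _ vs])
        (use w u borel_measurable_config in auto)
    show "(\<lambda>\<zeta>. config x0 s \<zeta> u) \<in> borel_measurable P"
      using w u by (intro borel_measurable_config) auto
  qed (use w in auto)
  ultimately show ?thesis by simp
qed

lemma AE_generic_sequence:
  "AE \<zeta> in P. (\<forall>i. CARD('k) \<le> i \<longrightarrow> i < n \<longrightarrow> aff_indep (config x0 s \<zeta>) {i - CARD('k)..<i})
     \<longrightarrow> generic_sequence (config x0 s \<zeta>) n"
proof -
  have "AE \<zeta> in P. \<forall>(p :: 'k \<Rightarrow> nat) w. CARD('k) \<le> w \<longrightarrow> w < n \<longrightarrow> range p \<subseteq> {..<w} \<longrightarrow>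
    normal (config x0 s \<zeta> \<circ> p) \<noteq> 0 \<longrightarrow>
    normal (config x0 s \<zeta> \<circ> p) \<bullet> (config x0 s \<zeta> w - config x0 s \<zeta> (p undefined)) \<noteq> 0"
    unfolding AE_all_countable using AE_config_off_hyperplane by (auto simp: AE_conj_iff)
  moreover have "AE \<zeta> in P. \<forall>vs u w. CARD('k) \<le> w \<longrightarrow> w < n \<longrightarrow> u < w \<longrightarrow> set vs \<subseteq> {CARD('k)..w} \<longrightarrow>
    fold (window_mirror (config x0 s \<zeta>)) vs (config x0 s \<zeta> u) \<noteq> config x0 s \<zeta> u \<longrightarrow>
    dist (config x0 s \<zeta> w) (fold (window_mirror (config x0 s \<zeta>)) vs (config x0 s \<zeta> u)) \<noteq>
    dist (config x0 s \<zeta> w) (config x0 s \<zeta> u)"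
    unfolding AE_all_countable using AE_config_not_equidistant by (auto simp: AE_conj_iff)
  ultimately show ?thesis
  proof eventually_elim
    case (elim \<zeta>)
    then show ?case unfolding generic_sequence_def by blast
  qed
qed

end

section \<open>From vertices to sequences\<close>

lemma reflect_in_fixes: "closed H \<Longrightarrow> x \<in> H \<Longrightarrow> reflect_in H x = x"
  by (simp add: reflect_in_def closest_point_self scaleR_2)

lemma dist_reflect_in:
  fixes H :: "'a::euclidean_space set"
  assumes H: "affine H" "H \<noteq> {}"
  shows "dist (reflect_in H x) (reflect_in H y) = dist x y"
proof -
  have cl: "closed H" and cv: "convex H" using H affine_closed affine_imp_convex by auto
  let ?c = "closest_point H"
  have mem: "?c x \<in> H" for x using closest_point_in_set[OF cl H(2)] .
  have orth: "(x - ?c x) \<bullet> (h - ?c x) = 0" if "h \<in> H" for x h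
  proof -
    have "2 *\<^sub>R ?c x + (- 1) *\<^sub>R h \<in> H"
      using H(1) mem[of x] that by (intro mem_affine) auto
    from closest_point_dot[OF cv cl this, of x] closest_point_dot[OF cv cl that, of x]
    show ?thesis by (simp add: inner_diff_right inner_add_right algebra_simps)
  qed
  let ?e = "?c x - ?c y"
  have "?e \<bullet> ((x - y) - ?e) = 0"
    using orth[OF mem[of y], of x] orth[OF mem[of x], of y]
    by (simp add: inner_diff_left inner_diff_right inner_commute algebra_simps)
  then have "(2 *\<^sub>R ?e - (x - y)) \<bullet> (2 *\<^sub>R ?e - (x - y)) = (x - y) \<bullet> (x - y)"
    by (simp add: inner_diff_left inner_diff_right inner_commute algebra_simps)
  moreover have "reflect_in H x - reflect_in H y = 2 *\<^sub>R ?e - (x - y)"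
    by (simp add: reflect_in_def algebra_simps)
  ultimately show ?thesis by (simp add: dist_norm norm_eq_sqrt_inner)
qed

definition vertex_at :: "'v::linorder set \<Rightarrow> nat \<Rightarrow> 'v" where
  "vertex_at V = (!) (sorted_list_of_set V)"

lemma bij_betw_vertex_at: "finite V \<Longrightarrow> bij_betw (vertex_at V) {..<card V} V"
  unfolding vertex_at_def by (rule bij_betw_nth) auto

lemma vertex_at_less_iff:
  assumes "i < card V" "j < card V"
  shows "vertex_at V i < vertex_at V j \<longleftrightarrow> i < j"
proof -
  have "sorted_wrt (<) (sorted_list_of_set V)" by simp
  then have "vertex_at V i < vertex_at V j" if "i < j" "j < card V" for i j
    using that unfolding vertex_at_def sorted_wrt_iff_nth_less by simp
  then show ?thesis using assms by (metis linorder_neqE_nat order_less_imp_not_less order_less_irrefl)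
qed

lemma valid_onD: "valid_on E d W x \<Longrightarrow> {u, v} \<in> E \<Longrightarrow> u \<in> W \<Longrightarrow> v \<in> W \<Longrightarrow> dist (x u) (x v) = d {u, v}"
  by (simp add: valid_on_def dist_norm)

context gdmdgp
begin

lemma inj_vertex_at: "inj_on (vertex_at V) {..<card V}"
  using bij_betw_vertex_at[OF finite_V] by (simp add: bij_betw_def)

lemma vertex_at_in: "j < card V \<Longrightarrow> vertex_at V j \<in> V"
  using bij_betw_vertex_at[OF finite_V] by (auto simp: bij_betw_def)

lemma vertex_at_cases:
  assumes "v \<in> V"
  obtains j where "j < card V" "v = vertex_at V j"
  using assms bij_betw_vertex_at[OF finite_V] by (auto simp: bij_betw_def)

lemma preds_vertex_at:
  assumes "j < card V"
  shows "preds V (vertex_at V j) = vertex_at V ` {..<j}"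
proof (intro set_eqI iffI)
  fix u assume "u \<in> preds V (vertex_at V j)"
  then have u: "u \<in> V" "u < vertex_at V j" by (auto simp: preds_def)
  obtain i where "i < card V" "u = vertex_at V i" using vertex_at_cases[OF u(1)] .
  then show "u \<in> vertex_at V ` {..<j}" using u(2) vertex_at_less_iff[OF _ assms] by auto
next
  fix u assume "u \<in> vertex_at V ` {..<j}"
  then obtain i where "i < j" "u = vertex_at V i" by auto
  then show "u \<in> preds V (vertex_at V j)"
    using assms vertex_at_in vertex_at_less_iff[of i V j] by (simp add: preds_def)
qed

lemma rank_of_vertex_at:
  assumes "j < card V"
  shows "rank_of V (vertex_at V j) = Suc j"
proof -
  have "inj_on (vertex_at V) {..<j}"
    using inj_vertex_at by (rule inj_on_subset) (use assms in auto)
  then show ?thesis by (simp add: rank_of_def preds_vertex_at[OF assms] card_image)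
qed

lemma vertex_at_V0_iff: "j < card V \<Longrightarrow> vertex_at V j \<in> V0 \<longleftrightarrow> j < CARD('k)"
  using V0_initial vertex_at_in by (auto simp: rank_of_vertex_at)

lemma free_vertices: "V - V0 = vertex_at V ` {CARD('k)..<card V}"
proof
  show "V - V0 \<subseteq> vertex_at V ` {CARD('k)..<card V}"
  proof
    fix v assume v: "v \<in> V - V0"
    then obtain j where j: "j < card V" "v = vertex_at V j" using vertex_at_cases by blast
    then have "CARD('k) \<le> j" using v vertex_at_V0_iff by auto
    then show "v \<in> vertex_at V ` {CARD('k)..<card V}" using j by auto
  qed
qed (auto simp: vertex_at_V0_iff vertex_at_in)

lemma U_vertex_at:
  assumes "CARD('k) \<le> i" "i < card V"
  shows "U (vertex_at V i) = vertex_at V ` {i - CARD('k)..<i}"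
proof (rule card_subset_eq)
  have v: "vertex_at V i \<in> V - V0" using assms vertex_at_in vertex_at_V0_iff by auto
  show "U (vertex_at V i) \<subseteq> vertex_at V ` {i - CARD('k)..<i}"
  proof
    fix u assume u: "u \<in> U (vertex_at V i)"
    then have "u \<in> vertex_at V ` {..<i}" using U_subset[OF v] preds_vertex_at[OF assms(2)] by auto
    then obtain j where j: "j < i" "u = vertex_at V j" by auto
    then have "Suc i - CARD('k) \<le> Suc j"
      using U_rank[OF v u] assms by (simp add: rank_of_vertex_at)
    then show "u \<in> vertex_at V ` {i - CARD('k)..<i}" using j by auto
  qed
  have "inj_on (vertex_at V) {i - CARD('k)..<i}"
    using inj_vertex_at by (rule inj_on_subset) (use assms in auto)
  then show "card (U (vertex_at V i)) = card (vertex_at V ` {i - CARD('k)..<i})"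
    using card_U[OF v] assms by (simp add: card_image)
qed simp

lemma dist_window:
  assumes y: "y \<in> embeddings V E d V0 xbar" and i: "CARD('k) \<le> i" "i < card V" and j: "j < i" "i \<le> j + CARD('k)"
  shows "dist (y (vertex_at V i)) (y (vertex_at V j)) = d {vertex_at V j, vertex_at V i}"
proof -
  have v: "vertex_at V i \<in> V - V0" using i vertex_at_in vertex_at_V0_iff by auto
  have "vertex_at V j \<in> U (vertex_at V i)" using i j by (auto simp: U_vertex_at)
  then have "{vertex_at V j, vertex_at V i} \<in> E" "vertex_at V j \<in> V"
    using U_subset[OF v] by (auto simp: nbrs_def preds_def)
  then show ?thesis using y v valid_onD[of E d V y "vertex_at V j" "vertex_at V i"]
    by (simp add: embeddings_def dist_commute)
qed

lemma aff_indep_window: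
  assumes y: "y \<in> embeddings V E d V0 xbar" and i: "CARD('k) \<le> i" "i < card V"
  shows "aff_indep (y \<circ> vertex_at V) {i - CARD('k)..<i}"
proof -
  have v: "vertex_at V i \<in> V - V0" using i vertex_at_in vertex_at_V0_iff by auto
  define p :: "'k \<Rightarrow> 'v" where "p = vertex_at V \<circ> window i"
  have "inj_on (vertex_at V) {i - CARD('k)..<i}"
    using inj_vertex_at by (rule inj_on_subset) (use i in auto)
  then have "bij_betw (vertex_at V) {i - CARD('k)..<i} (U (vertex_at V i))"
    unfolding U_vertex_at[OF i] by (rule inj_on_imp_bij_betw)
  then have p: "bij_betw p UNIV (U (vertex_at V i))"
    unfolding p_def by (rule bij_betw_trans[OF bij_betw_window[OF i(1)]])
  have "simplex_volume d p > 0" by (rule simplex_pos[OF v p])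
  then have "cayley_menger d p \<noteq> 0" by (auto simp: simplex_volume_def)
  then have "aff_indep (y \<circ> p) UNIV"
  proof (rule cayley_menger_aff_indep)
    fix a b :: 'k assume "a \<noteq> b"
    then have ne: "p a \<noteq> p b" using p by (auto simp: bij_betw_def inj_eq)
    have pU: "p r \<in> U (vertex_at V i)" for r using p by (auto simp: bij_betw_def)
    then have "p r \<in> V" for r using U_subset[OF v] by (auto simp: preds_def)
    then show "d {p a, p b} = dist ((y \<circ> p) a) ((y \<circ> p) b)"
      using y U_complete[OF v pU pU ne] valid_onD[of E d V y "p a" "p b"] by (simp add: embeddings_def)
  qed
  then show ?thesis
    using aff_indep_reindex[OF bij_betw_window[OF i(1)], of "y \<circ> vertex_at V"]
    by (simp add: p_def comp_assoc)
qed

lemma partial_reflection_embedding: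
  assumes y: "y \<in> embeddings V E d V0 xbar" and v: "v \<in> V - V0"
    and sep: "\<And>u w. {u, w} \<in> E \<Longrightarrow> u \<in> V \<Longrightarrow> w \<in> V \<Longrightarrow> u < v \<Longrightarrow> v \<le> w \<Longrightarrow> u \<in> U v"
  shows "partial_reflection V U v y \<in> embeddings V E d V0 xbar"
proof -
  define H where "H = affine hull (y ` U v)"
  let ?x = "partial_reflection V U v y"
  have U_ne: "U v \<noteq> {}" using card_U[OF v] by auto
  have aff: "affine H" "H \<noteq> {}" using U_ne by (auto simp: H_def)
  have val: "valid_on E d V y" using y by (simp add: embeddings_def)
  have fixU: "reflect_in H (y u) = y u" if "u \<in> U v" for u
    using that affine_closed[OF aff(1)] by (intro reflect_in_fixes) (auto simp: H_def hull_inc)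
  have x: "w \<in> V \<Longrightarrow> ?x w = (if w < v then y w else reflect_in H (y w))" for w
    by (simp add: partial_reflection_def H_def)
  have cross: "dist (?x u) (?x w) = d {u, w}" if "{u, w} \<in> E" "u \<in> V" "w \<in> V" "u < v" "v \<le> w" for u w
  proof -
    have "?x u = reflect_in H (y u)" using that sep[OF that] fixU by (simp add: x)
    moreover have "?x w = reflect_in H (y w)" using that leD[OF that(5)] by (simp add: x)
    ultimately have "dist (?x u) (?x w) = dist (y u) (y w)"
      by (simp only: dist_reflect_in[OF aff])
    then show ?thesis using valid_onD[OF val] that by simp
  qed
  have "dist (?x u) (?x w) = d {u, w}" if uw: "{u, w} \<in> E" "u \<in> V" "w \<in> V" for u w
  proof (cases "u < v"; cases "w < v")
    assume "u < v" "w < v"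
    then show ?thesis using valid_onD[OF val] uw by (simp add: x)
  next
    assume "\<not> u < v" "\<not> w < v"
    then show ?thesis using valid_onD[OF val] uw dist_reflect_in[OF aff] by (simp add: x)
  next
    assume "u < v" "\<not> w < v"
    then show ?thesis using cross uw by simp
  next
    assume "\<not> u < v" "w < v"
    then show ?thesis using cross[of w u] uw by (simp add: insert_commute dist_commute)
  qed
  moreover have "?x w = xbar w" if w: "w \<in> V0" for w
  proof -
    have wV: "w \<in> V" using w V0_subset by auto
    have "w < v"
    proof (rule ccontr)
      assume "\<not> w < v"
      then have "preds V v \<subseteq> preds V w" by (auto simp: preds_def)
      then have "rank_of V v \<le> rank_of V w"
        using finite_V by (simp add: rank_of_def card_mono preds_def)
      then show False using v w V0_initial by auto
    qed
    then show ?thesis using x[OF wV] y w by (simp add: embeddings_def)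
  qed
  moreover have "?x \<in> V \<rightarrow>\<^sub>E UNIV" by (auto simp: partial_reflection_def)
  ultimately show ?thesis by (simp add: embeddings_def valid_on_def dist_norm)
qed

lemma config_eq:
  assumes "z \<in> embeddings V E d V0 xbar" "j < card V"
  shows "config (xbar \<circ> vertex_at V) (vertex_at V) (restrict z (V - V0)) j = z (vertex_at V j)"
  using assms vertex_at_V0_iff[of j] vertex_at_in[of j] by (auto simp: config_def embeddings_def)

lemma partial_reflection_generic:
  assumes z: "z \<in> embeddings V E d V0 xbar"
    and gen: "generic_sequence (config (xbar \<circ> vertex_at V) (vertex_at V) (restrict z (V - V0))) (card V)"
    and y: "y \<in> embeddings V E d V0 xbar" and y': "y' \<in> embeddings V E d V0 xbar"
    and v: "v \<in> V - V0" and below: "\<And>w. w \<in> V \<Longrightarrow> w < v \<Longrightarrow> y' w = y w" and ne: "y' v \<noteq> y v"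
  shows "partial_reflection V U v y \<in> embeddings V E d V0 xbar"
proof (rule partial_reflection_embedding[OF y v])
  fix u w
  assume edge: "{u, w} \<in> E" and V: "u \<in> V" "w \<in> V" and uv: "u < v" "v \<le> w"
  let ?s = "vertex_at V"
  let ?z = "config (xbar \<circ> ?s) ?s (restrict z (V - V0))"
  obtain i where i: "i < card V" "v = ?s i" using vertex_at_cases[of v] v by blast
  obtain a where a: "a < card V" "u = ?s a" using vertex_at_cases[OF V(1)] by blast
  obtain b where b: "b < card V" "w = ?s b" using vertex_at_cases[OF V(2)] by blast
  have Ki: "CARD('k) \<le> i" using v i vertex_at_V0_iff by auto
  have ai: "a < i" using uv i a vertex_at_less_iff by auto
  have ib: "i \<le> b" using uv i b vertex_at_less_iff[of b V i] by auto
  have init: "(x \<circ> ?s) j = ?z j" if "x \<in> embeddings V E d V0 xbar" "j < CARD('k)" "j < card V" for x j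
    using that vertex_at_V0_iff[of j] by (auto simp: config_def embeddings_def)
  have win: "dist ((x \<circ> ?s) i) ((x \<circ> ?s) j) = dist (?z i) (?z j)"
    if "x \<in> embeddings V E d V0 xbar" "CARD('k) \<le> i" "i < card V" "j < i" "i \<le> j + CARD('k)" for x i j
    using that dist_window[OF that] dist_window[OF z that(2-)] config_eq[OF z] by simp
  have ed: "dist ((x \<circ> ?s) a) ((x \<circ> ?s) b) = dist (?z a) (?z b)"
    if "x \<in> embeddings V E d V0 xbar" for x
  proof -
    have "valid_on E d V x" "valid_on E d V z" using that z by (simp_all add: embeddings_def)
    then have "dist (x u) (x w) = dist (z u) (z w)" using valid_onD[OF _ edge V] by metis
    then show ?thesis using a b config_eq[OF z] by simp
  qed
  show "u \<in> U v"
  proof (rule ccontr)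
    assume "u \<notin> U v"
    then have "a \<notin> {i - CARD('k)..<i}" unfolding i a U_vertex_at[OF Ki i(1)] by blast
    then have far: "a + CARD('k) < i" using ai by auto
    have below': "(y' \<circ> ?s) j = (y \<circ> ?s) j" if "j < i" for j
      using that below[of "?s j"] i vertex_at_in[of j] vertex_at_less_iff[of j V i] by simp
    have ne': "(y' \<circ> ?s) i \<noteq> (y \<circ> ?s) i" using ne i by simp
    show False
      by (rule generic_sequence.no_edge_across_branching[OF gen init[OF y] win[OF y] init[OF y'] win[OF y']
            below' ne' far ib b(1) ed[OF y] ed[OF y']])
  qed
qed

end

theorem theorem1:
  fixes V V0 :: "'v::linorder set"
    and E :: "'v set set"
    and xbar :: "'v \<Rightarrow> real ^ 'k"
    and U :: "'v \<Rightarrow> 'v set"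
    and M :: "'w measure"
    and d :: "'w \<Rightarrow> 'v set \<Rightarrow> real"
    and z :: "'w \<Rightarrow> 'v \<Rightarrow> real ^ 'k"
  assumes "prob_space M"
    and instance_of: "\<And>\<omega>. \<omega> \<in> space M \<Longrightarrow> gdmdgp V E (d \<omega>) V0 xbar U"
    and realized: "\<And>\<omega>. \<omega> \<in> space M \<Longrightarrow> z \<omega> \<in> embeddings V E (d \<omega>) V0 xbar"
    and generic: "generic_points M (V - V0) z"
  shows "AE \<omega> in M. \<forall>y \<in> embeddings V E (d \<omega>) V0 xbar. \<forall>v \<in> V - V0.
           (\<exists>y' \<in> embeddings V E (d \<omega>) V0 xbar. (\<forall>w\<in>V. w < v \<longrightarrow> y' w = y w) \<and> y' v \<noteq> y v) \<longrightarrow>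
           partial_reflection V U v y \<in> embeddings V E (d \<omega>) V0 xbar"
proof -
  obtain \<omega>0 where "\<omega>0 \<in> space M" using prob_space.not_empty[OF assms(1)] by blast
  then interpret g0: gdmdgp V E "d \<omega>0" V0 xbar U by (rule instance_of)
  let ?s = "vertex_at V"
  let ?z = "\<lambda>\<omega>. config (xbar \<circ> ?s) ?s (restrict (z \<omega>) (V - V0))"
  let ?P = "\<Pi>\<^sub>M i\<in>V - V0. (lborel :: (real ^ 'k) measure)"
  have meas: "(\<lambda>\<omega>. restrict (z \<omega>) (V - V0)) \<in> M \<rightarrow>\<^sub>M ?P"
    and ac: "absolutely_continuous ?P (distr M ?P (\<lambda>\<omega>. restrict (z \<omega>) (V - V0)))"
    using generic by (auto simp: generic_points_def)
  have "AE \<zeta> in distr M ?P (\<lambda>\<omega>. restrict (z \<omega>) (V - V0)).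
      (\<forall>i. CARD('k) \<le> i \<longrightarrow> i < card V \<longrightarrow> aff_indep (config (xbar \<circ> ?s) ?s \<zeta>) {i - CARD('k)..<i})
      \<longrightarrow> generic_sequence (config (xbar \<circ> ?s) ?s \<zeta>) (card V)"
    using AE_generic_sequence[OF g0.inj_vertex_at, of "xbar \<circ> ?s", folded g0.free_vertices]
    by (intro absolutely_continuous_AE[OF _ ac]) auto
  from AE_distrD[OF meas this]
  show ?thesis
  proof (rule AE_mp, intro AE_I2 impI ballI)
    fix \<omega> y v
    assume \<omega>: "\<omega> \<in> space M" and
      gen: "(\<forall>i. CARD('k) \<le> i \<longrightarrow> i < card V \<longrightarrow> aff_indep (?z \<omega>) {i - CARD('k)..<i})
      \<longrightarrow> generic_sequence (?z \<omega>) (card V)"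
      and y: "y \<in> embeddings V E (d \<omega>) V0 xbar" and v: "v \<in> V - V0"
      and ex: "\<exists>y' \<in> embeddings V E (d \<omega>) V0 xbar. (\<forall>w\<in>V. w < v \<longrightarrow> y' w = y w) \<and> y' v \<noteq> y v"
    interpret gdmdgp V E "d \<omega>" V0 xbar U using \<omega> by (rule instance_of)
    note z = realized[OF \<omega>]
    have "aff_indep (?z \<omega>) {i - CARD('k)..<i}" if "CARD('k) \<le> i" "i < card V" for i
    proof -
      have "aff_indep (?z \<omega>) {i - CARD('k)..<i} \<longleftrightarrow> aff_indep (z \<omega> \<circ> ?s) {i - CARD('k)..<i}"
        by (rule aff_indep_cong) (use config_eq[OF z] that in simp)
      then show ?thesis using aff_indep_window[OF z that] by simp
    qed
    then have "generic_sequence (?z \<omega>) (card V)" using gen by blast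
    then show "partial_reflection V U v y \<in> embeddings V E (d \<omega>) V0 xbar"
      using partial_reflection_generic[OF z _ y _ v] ex by blast
  qed
qed

end
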